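(* Let $\alpha\in[0,1]$ and consider the data markets game in which the platform charges each buyer $i$ the transaction cost $\mathcal{T}_i(S)=\alpha\big(\sum_{j\ne i}\hat{E}_{ji}(\gamma_i)-\sum_{j\ne i}\hat{E}_{ij}(\gamma_j)\big)$. Then it is a dominant strategy for every buyer $i$ to select $$\gamma_i^d\in\arg\max_{\gamma}\Big\{g_i(\gamma)-\alpha\sum_{j\ne i}\hat{e}_{ji}(\gamma)\Big\}=\arg\max_\gamma u_i^e(\gamma).$$ Further, on every instance $\mathrm{WRaE}\le n(1-\alpha)+\Delta_b^{max}$, and the worst-case WRaE is lower bounded by $n(1-\alpha)$: for every $n\ge2$, every $\alpha\in[0,1]$ and every $\eta>0$ there is an instance with $n$ buyers and parameter $\alpha$ for which $\mathrm{WRaE}\ge n(1-\alpha)-\eta$.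
   Context: Data markets game: there are $n$ buyers and $k$ sellers; $\Gamma$ is the power set of the set of sellers. Each buyer $i$ simultaneously chooses a seller set (order) $\gamma_i\in\Gamma$; $S=(\gamma_1,\dots,\gamma_n)$ is the order profile. Buyer $i$ has a random performance increase $P_i(\gamma)\in[0,1]$, and sellers charge a cost $c(\gamma)\in[0,1]$, with $P_i(\emptyset)=0$ and $c(\emptyset)=0$. The net gain is $G_i(\gamma)=P_i(\gamma)-c(\gamma)\in[-1,1]$ with mean $g_i(\gamma)$. Buyer $i$ suffers from buyer $j\neq i$ a nonnegative random externality $E_{ij}(\gamma_j)$ depending on $j$'s order, with mean $e_{ij}(\gamma_j)$, normalized so that $\sum_{j\ne i}E_{ji}(\gamma)\in[0,1]$ for every $i$ and $\gamma$. Expected utility: $u_i(S)=\mathbb{E}\big[G_i(\gamma_i)-\sum_{j\ne i}E_{ij}(\gamma_j)-\mathcal{T}_i(S)\big]$. Social welfare: $sw(S)=\sum_i u_i(S)$. Predicted externality: the platform has random predictions $\hat{E}_{ij}(\gamma)$ of $E_{ij}(\gamma)$, with means $\hat{e}_{ij}(\gamma)$, satisfying the same normalization $\sum_{j\ne i}\hat{E}_{ji}(\gamma)\in[0,1]$. The bias is $b_{ij}(\gamma)=e_{ij}(\gamma)-\hat{e}_{ij}(\gamma)$, and $\Delta_b^{max}=\sum_{i\ne j}\max_{\gamma^1,\gamma^2}|b_{ij}(\gamma^1)-b_{ij}(\gamma^2)|$ (sum over ordered pairs $(i,j)$, $i\neq j$). The expected effective utility of buyer $i$ is $u_i^e(\gamma)=g_i(\gamma)-\alpha\sum_{j\ne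 i}\hat{e}_{ji}(\gamma)$. An instance is a tuple $\mathcal{I}=(g_i,e_{ij},b_{ij},\alpha)$. WRaE (welfare regret at equilibrium): $\mathrm{WRaE}=sw(S^* )-\max_{S\in\mathcal{S}^q}sw(S)$, where $S^*$ maximizes $sw$ and $\mathcal{S}^q$ is the set of pure Nash equilibria. *)

theory Defs
  imports "HOL-Probability.Probability"
begin

text \<open>
  Buyers are \<open>0, \<dots>, n - 1\<close> and sellers are \<open>0, \<dots>, k - 1\<close>.  All random quantities live on one
  probability space, with no independence assumption.  \<open>extern D i j \<gamma>\<close> is the externality that
  buyer \<open>i\<close> suffers when buyer \<open>j\<close> orders \<open>\<gamma>\<close>, and \<open>pred_extern D i j \<gamma>\<close> is its prediction.
\<close>

record 'w market =
  num_buyers :: nat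
  num_sellers :: nat
  outcomes :: "'w measure"
  perf :: "nat \<Rightarrow> nat set \<Rightarrow> 'w \<Rightarrow> real"
  cost :: "nat set \<Rightarrow> real"
  extern :: "nat \<Rightarrow> nat \<Rightarrow> nat set \<Rightarrow> 'w \<Rightarrow> real"
  pred_extern :: "nat \<Rightarrow> nat \<Rightarrow> nat set \<Rightarrow> 'w \<Rightarrow> real"

definition buyers :: "'w market \<Rightarrow> nat set" where
  "buyers D = {..<num_buyers D}"

definition orders :: "'w market \<Rightarrow> nat set set" where
  "orders D = Pow {..<num_sellers D}"

definition profiles :: "'w market \<Rightarrow> (nat \<Rightarrow> nat set) set" where
  "profiles D = (buyers D \<rightarrow>\<^sub>E orders D)"

locale data_market =
  fixes D :: "'w market"
  assumes prob_space_outcomes: "prob_space (outcomes D)"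
    and perf_measurable:
      "\<lbrakk>i \<in> buyers D; \<gamma> \<in> orders D\<rbrakk> \<Longrightarrow> perf D i \<gamma> \<in> borel_measurable (outcomes D)"
    and perf_range:
      "\<lbrakk>i \<in> buyers D; \<gamma> \<in> orders D; \<omega> \<in> space (outcomes D)\<rbrakk> \<Longrightarrow> perf D i \<gamma> \<omega> \<in> {0..1}"
    and perf_empty:
      "\<lbrakk>i \<in> buyers D; \<omega> \<in> space (outcomes D)\<rbrakk> \<Longrightarrow> perf D i {} \<omega> = 0"
    and cost_range: "\<gamma> \<in> orders D \<Longrightarrow> cost D \<gamma> \<in> {0..1}"
    and cost_empty: "cost D {} = 0"
    and extern_measurable:
      "\<lbrakk>i \<in> buyers D; j \<in> buyers D; i \<noteq> j; \<gamma> \<in> orders D\<rbrakk>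
        \<Longrightarrow> extern D i j \<gamma> \<in> borel_measurable (outcomes D)"
    and extern_nonneg:
      "\<lbrakk>i \<in> buyers D; j \<in> buyers D; i \<noteq> j; \<gamma> \<in> orders D; \<omega> \<in> space (outcomes D)\<rbrakk>
        \<Longrightarrow> 0 \<le> extern D i j \<gamma> \<omega>"
    and extern_normalized:
      "\<lbrakk>i \<in> buyers D; \<gamma> \<in> orders D; \<omega> \<in> space (outcomes D)\<rbrakk>
        \<Longrightarrow> (\<Sum>j\<in>buyers D - {i}. extern D j i \<gamma> \<omega>) \<in> {0..1}"
    and pred_extern_integrable:
      "\<lbrakk>i \<in> buyers D; j \<in> buyers D; i \<noteq> j; \<gamma> \<in> orders D\<rbrakk>
        \<Longrightarrow> integrable (outcomes D) (pred_extern D i j \<gamma>)"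
    and pred_extern_normalized:
      "\<lbrakk>i \<in> buyers D; \<gamma> \<in> orders D; \<omega> \<in> space (outcomes D)\<rbrakk>
        \<Longrightarrow> (\<Sum>j\<in>buyers D - {i}. pred_extern D j i \<gamma> \<omega>) \<in> {0..1}"

definition gain :: "'w market \<Rightarrow> nat \<Rightarrow> nat set \<Rightarrow> 'w \<Rightarrow> real" where
  "gain D i \<gamma> \<omega> = perf D i \<gamma> \<omega> - cost D \<gamma>"

definition mean_gain :: "'w market \<Rightarrow> nat \<Rightarrow> nat set \<Rightarrow> real" where
  "mean_gain D i \<gamma> = (\<integral>\<omega>. gain D i \<gamma> \<omega> \<partial>outcomes D)"

definition mean_extern :: "'w market \<Rightarrow> nat \<Rightarrow> nat \<Rightarrow> nat set \<Rightarrow> real" where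
  "mean_extern D i j \<gamma> = (\<integral>\<omega>. extern D i j \<gamma> \<omega> \<partial>outcomes D)"

definition mean_pred_extern :: "'w market \<Rightarrow> nat \<Rightarrow> nat \<Rightarrow> nat set \<Rightarrow> real" where
  "mean_pred_extern D i j \<gamma> = (\<integral>\<omega>. pred_extern D i j \<gamma> \<omega> \<partial>outcomes D)"

definition bias :: "'w market \<Rightarrow> nat \<Rightarrow> nat \<Rightarrow> nat set \<Rightarrow> real" where
  "bias D i j \<gamma> = mean_extern D i j \<gamma> - mean_pred_extern D i j \<gamma>"

definition max_bias_variation :: "'w market \<Rightarrow> real" where
  "max_bias_variation D =
    (\<Sum>i\<in>buyers D. \<Sum>j\<in>buyers D - {i}.
      Max ((\<lambda>(\<gamma>1, \<gamma>2). \<bar>bias D i j \<gamma>1 - bias D i j \<gamma>2\<bar>) ` (orders D \<times> orders D)))"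

text \<open>
  The game is parametrised by a transaction cost rule \<open>T\<close>: buyer \<open>i\<close> pays \<open>T i S \<omega>\<close> when the
  order profile is \<open>S\<close> and the outcome is \<open>\<omega>\<close>.
\<close>

type_synonym 'w cost_rule = "nat \<Rightarrow> (nat \<Rightarrow> nat set) \<Rightarrow> 'w \<Rightarrow> real"

definition utility :: "'w market \<Rightarrow> 'w cost_rule \<Rightarrow> nat \<Rightarrow> (nat \<Rightarrow> nat set) \<Rightarrow> real" where
  "utility D T i S =
    (\<integral>\<omega>. gain D i (S i) \<omega> - (\<Sum>j\<in>buyers D - {i}. extern D i j (S j) \<omega>) - T i S \<omega> \<partial>outcomes D)"

definition social_welfare :: "'w market \<Rightarrow> 'w cost_rule \<Rightarrow> (nat \<Rightarrow> nat set) \<Rightarrow> real" where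
  "social_welfare D T S = (\<Sum>i\<in>buyers D. utility D T i S)"

definition dominant_strategy :: "'w market \<Rightarrow> 'w cost_rule \<Rightarrow> nat \<Rightarrow> nat set \<Rightarrow> bool" where
  "dominant_strategy D T i \<gamma>d \<longleftrightarrow> \<gamma>d \<in> orders D \<and>
    (\<forall>S\<in>profiles D. \<forall>\<gamma>\<in>orders D. utility D T i (S(i := \<gamma>)) \<le> utility D T i (S(i := \<gamma>d)))"

definition pure_nash :: "'w market \<Rightarrow> 'w cost_rule \<Rightarrow> (nat \<Rightarrow> nat set) set" where
  "pure_nash D T = {S \<in> profiles D.
    \<forall>i\<in>buyers D. \<forall>\<gamma>\<in>orders D. utility D T i (S(i := \<gamma>)) \<le> utility D T i S}"

text \<open>Meaningful only if \<open>pure_nash D T\<close> is nonempty, because \<open>Max {}\<close> is unspecified.\<close>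

definition WRaE :: "'w market \<Rightarrow> 'w cost_rule \<Rightarrow> real" where
  "WRaE D T =
    Max (social_welfare D T ` profiles D) - Max (social_welfare D T ` pure_nash D T)"

definition transaction_cost :: "'w market \<Rightarrow> real \<Rightarrow> 'w cost_rule" where
  "transaction_cost D \<alpha> i S \<omega> =
    \<alpha> * ((\<Sum>j\<in>buyers D - {i}. pred_extern D j i (S i) \<omega>)
        - (\<Sum>j\<in>buyers D - {i}. pred_extern D i j (S j) \<omega>))"

definition effective_utility :: "'w market \<Rightarrow> real \<Rightarrow> nat \<Rightarrow> nat set \<Rightarrow> real" where
  "effective_utility D \<alpha> i \<gamma> =
    mean_gain D i \<gamma> - \<alpha> * (\<Sum>j\<in>buyers D - {i}. mean_pred_extern D j i \<gamma>)"

end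

theory Submission
  imports Defs
begin

text \<open>
  Transfers cancel in the social welfare, so both the welfare and the part of a buyer's utility that
  the buyer controls are separable over orders.  The order \<open>\<gamma>\<close> of buyer \<open>i\<close> contributes
  \<open>u\<^sub>i\<^sup>e(\<gamma>) - (1 - \<alpha>) \<Sum>\<^sub>j e'\<^sub>j\<^sub>i(\<gamma>) - \<Sum>\<^sub>j b\<^sub>j\<^sub>i(\<gamma>)\<close> to the welfare, where \<open>e'\<close> is the mean predicted
  externality, while an equilibrium order maximises \<open>u\<^sub>i\<^sup>e\<close>.  Replacing it by any other order
  gains at most \<open>1 - \<alpha>\<close> plus the variation of the biases.  The bound is approached when every
  order has value slightly above \<open>\<alpha>\<close> and total externality \<open>1\<close>: ordering is then strictly
  dominant, although nobody ordering is better for the buyers together.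
\<close>

section \<open>Double sums over ordered pairs, and finiteness of the game\<close>

text \<open>Being distinct is a symmetric relation. The exchange turns a sum over the externalities
  that buyers suffer into one over those that they cause, and it makes the transfers cancel.\<close>

lemma sum_off_diagonal_swap:
  fixes f :: "'a \<Rightarrow> 'a \<Rightarrow> 'b::comm_monoid_add"
  assumes "finite A"
  shows "(\<Sum>i\<in>A. \<Sum>j\<in>A - {i}. f i j) = (\<Sum>i\<in>A. \<Sum>j\<in>A - {i}. f j i)"
proof -
  have "A - {i} = {j \<in> A. i \<noteq> j}" "A - {i} = {j \<in> A. j \<noteq> i}" for i
    by auto
  then show ?thesis
    using sum.swap_restrict[OF assms assms, of f "(\<noteq>)"] by simp
qed

lemma fun_upd_profiles:
  assumes "S \<in> profiles D" "i \<in> buyers D" "\<gamma> \<in> orders D"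
  shows "S(i := \<gamma>) \<in> profiles D"
  using assms unfolding profiles_def by (auto simp: PiE_iff extensional_def)

lemma profiles_apply: "S \<in> profiles D \<Longrightarrow> i \<in> buyers D \<Longrightarrow> S i \<in> orders D"
  unfolding profiles_def by auto

lemma finite_buyers [simp]: "finite (buyers D)"
  by (simp add: buyers_def)

lemma finite_orders [simp]: "finite (orders D)"
  by (simp add: orders_def)

lemma orders_nonempty [simp]: "orders D \<noteq> {}"
  by (auto simp: orders_def)

lemma finite_profiles [simp]: "finite (profiles D)"
  unfolding profiles_def by (intro finite_PiE) auto

lemma finite_pure_nash [simp]: "finite (pure_nash D T)"
  unfolding pure_nash_def by simp

text \<open>The externalities subtracted are those that \<open>i\<close> imposes on the others, not
  those that \<open>i\<close> suffers, so the value depends on the order of \<open>i\<close>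
  alone.\<close>

definition welfare_contribution :: "'w market \<Rightarrow> nat \<Rightarrow> nat set \<Rightarrow> real" where
  "welfare_contribution D i \<gamma> = mean_gain D i \<gamma> - (\<Sum>j\<in>buyers D - {i}. mean_extern D j i \<gamma>)"

section \<open>Integrability and expected utilities\<close>

context data_market
begin

lemma integrable_gain:
  assumes "i \<in> buyers D" "\<gamma> \<in> orders D"
  shows "integrable (outcomes D) (gain D i \<gamma>)"
proof -
  interpret prob_space "outcomes D" by (rule prob_space_outcomes)
  have "integrable (outcomes D) (perf D i \<gamma>)"
    using perf_range[OF assms]
    by (intro integrable_const_bound[where B = 1] AE_I2 perf_measurable assms) auto
  then show ?thesis
    unfolding gain_def by simp
qed

text \<open>By nonnegativity each externality is bounded by the normalized total of which it is a
  summand.\<close>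

lemma integrable_extern:
  assumes "i \<in> buyers D" "j \<in> buyers D" "i \<noteq> j" "\<gamma> \<in> orders D"
  shows "integrable (outcomes D) (extern D i j \<gamma>)"
proof -
  interpret prob_space "outcomes D" by (rule prob_space_outcomes)
  have "norm (extern D i j \<gamma> \<omega>) \<le> 1" if w: "\<omega> \<in> space (outcomes D)" for \<omega>
  proof -
    have "extern D i j \<gamma> \<omega> \<le> (\<Sum>l\<in>buyers D - {j}. extern D l j \<gamma> \<omega>)"
      using assms w by (intro member_le_sum extern_nonneg) auto
    also have "\<dots> \<le> 1"
      using extern_normalized[OF assms(2,4) w] by simp
    finally show ?thesis
      using extern_nonneg[OF assms w] by simp
  qed
  then show ?thesis
    by (intro integrable_const_bound[where B = 1] AE_I2 extern_measurable assms) auto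
qed

text \<open>The pointwise normalization passes to expectations. This yields the term 1 - \<alpha>
  per buyer in the upper bound on the regret.\<close>

lemma sum_mean_pred_extern_range:
  assumes "i \<in> buyers D" "\<gamma> \<in> orders D"
  shows "(\<Sum>j\<in>buyers D - {i}. mean_pred_extern D j i \<gamma>) \<in> {0..1}"
proof -
  interpret prob_space "outcomes D" by (rule prob_space_outcomes)
  let ?f = "\<lambda>\<omega>. \<Sum>j\<in>buyers D - {i}. pred_extern D j i \<gamma> \<omega>"
  have int: "integrable (outcomes D) ?f"
    using assms by (intro Bochner_Integration.integrable_sum pred_extern_integrable) auto
  have "(\<Sum>j\<in>buyers D - {i}. mean_pred_extern D j i \<gamma>) = (\<integral>\<omega>. ?f \<omega> \<partial>outcomes D)"
    unfolding mean_pred_extern_def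
    using assms by (intro Bochner_Integration.integral_sum[symmetric] pred_extern_integrable) auto
  moreover have "0 \<le> (\<integral>\<omega>. ?f \<omega> \<partial>outcomes D)"
    using pred_extern_normalized[OF assms] by (intro integral_nonneg_AE AE_I2) auto
  moreover have "(\<integral>\<omega>. ?f \<omega> \<partial>outcomes D) \<le> 1"
    using pred_extern_normalized[OF assms] by (intro integral_le_const int AE_I2) auto
  ultimately show ?thesis
    by simp
qed

text \<open>Linearity of expectation separates what the order of \<open>i\<close> determines, the
  effective utility, from a remainder fixed by the orders of the other buyers.\<close>

lemma utility_eq:
  assumes S: "S \<in> profiles D" and i: "i \<in> buyers D"
  shows "utility D (transaction_cost D \<alpha>) i S =
    effective_utility D \<alpha> i (S i) -
      ((\<Sum>j\<in>buyers D - {i}. mean_extern D i j (S j))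
        - \<alpha> * (\<Sum>j\<in>buyers D - {i}. mean_pred_extern D i j (S j)))"
proof -
  note ord = profiles_apply[OF S]
  have e: "integrable (outcomes D) (extern D i j (S j))" if "j \<in> buyers D - {i}" for j
    using that i ord by (intro integrable_extern) auto
  have p: "integrable (outcomes D) (pred_extern D i j (S j))" if "j \<in> buyers D - {i}" for j
    using that i ord by (intro pred_extern_integrable) auto
  have q: "integrable (outcomes D) (pred_extern D j i (S i))" if "j \<in> buyers D - {i}" for j
    using that i ord by (intro pred_extern_integrable) auto
  note g = integrable_gain[OF i ord[OF i]]
  let ?M = "outcomes D"
  let ?E = "\<lambda>\<omega>. \<Sum>j\<in>buyers D - {i}. extern D i j (S j) \<omega>"
  let ?P = "\<lambda>\<omega>. \<Sum>j\<in>buyers D - {i}. pred_extern D i j (S j) \<omega>"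
  let ?Q = "\<lambda>\<omega>. \<Sum>j\<in>buyers D - {i}. pred_extern D j i (S i) \<omega>"
  have int: "integrable ?M ?E" "integrable ?M ?P" "integrable ?M ?Q"
    using e p q by (auto intro!: Bochner_Integration.integrable_sum)
  have eq: "(\<integral>\<omega>. ?E \<omega> \<partial>?M) = (\<Sum>j\<in>buyers D - {i}. mean_extern D i j (S j))"
    "(\<integral>\<omega>. ?P \<omega> \<partial>?M) = (\<Sum>j\<in>buyers D - {i}. mean_pred_extern D i j (S j))"
    "(\<integral>\<omega>. ?Q \<omega> \<partial>?M) = (\<Sum>j\<in>buyers D - {i}. mean_pred_extern D j i (S i))"
    unfolding mean_extern_def mean_pred_extern_def
    using e p q by (auto intro!: Bochner_Integration.integral_sum)
  have "utility D (transaction_cost D \<alpha>) i S =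
      (\<integral>\<omega>. gain D i (S i) \<omega> \<partial>?M) - (\<integral>\<omega>. ?E \<omega> \<partial>?M)
        - \<alpha> * ((\<integral>\<omega>. ?Q \<omega> \<partial>?M) - (\<integral>\<omega>. ?P \<omega> \<partial>?M))"
    unfolding utility_def transaction_cost_def
    by (simp only: g int Bochner_Integration.integral_diff Bochner_Integration.integrable_diff
        integral_mult_right_zero integrable_mult_right)
  then show ?thesis
    unfolding eq effective_utility_def mean_gain_def by (simp add: algebra_simps)
qed

text \<open>The remainder in \<open>utility_eq\<close> involves only buyers other than
  \<open>i\<close>, so it cancels.\<close>

lemma utility_deviation:
  assumes "S \<in> profiles D" "i \<in> buyers D" "\<gamma> \<in> orders D"
  shows "utility D (transaction_cost D \<alpha>) i (S(i := \<gamma>)) - utility D (transaction_cost D \<alpha>) i S =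
    effective_utility D \<alpha> i \<gamma> - effective_utility D \<alpha> i (S i)"
proof -
  have "(\<Sum>j\<in>buyers D - {i}. mean_extern D i j ((S(i := \<gamma>)) j)) =
      (\<Sum>j\<in>buyers D - {i}. mean_extern D i j (S j))"
    "(\<Sum>j\<in>buyers D - {i}. mean_pred_extern D i j ((S(i := \<gamma>)) j)) =
      (\<Sum>j\<in>buyers D - {i}. mean_pred_extern D i j (S j))"
    by (auto intro: sum.cong)
  then show ?thesis
    using utility_eq[OF fun_upd_profiles[OF assms] assms(2), of \<alpha>]
      utility_eq[OF assms(1,2), of \<alpha>] by simp
qed

section \<open>Dominant strategies and equilibria\<close>

lemma dominant_strategy_if_arg_max:
  assumes i: "i \<in> buyers D"
    and max: "is_arg_max (effective_utility D \<alpha> i) (\<lambda>\<gamma>. \<gamma> \<in> orders D) \<gamma>d"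
  shows "dominant_strategy D (transaction_cost D \<alpha>) i \<gamma>d"
  unfolding dominant_strategy_def
proof (intro conjI ballI)
  show d: "\<gamma>d \<in> orders D"
    using max by (simp add: is_arg_max_def)
  fix S \<gamma> assume S: "S \<in> profiles D" and \<gamma>: "\<gamma> \<in> orders D"
  have "effective_utility D \<alpha> i \<gamma> \<le> effective_utility D \<alpha> i \<gamma>d"
    using max \<gamma> by (auto simp: is_arg_max_linorder)
  then show "utility D (transaction_cost D \<alpha>) i (S(i := \<gamma>))
      \<le> utility D (transaction_cost D \<alpha>) i (S(i := \<gamma>d))"
    using utility_deviation[OF S i \<gamma>, of \<alpha>] utility_deviation[OF S i d, of \<alpha>] by simp
qed

text \<open>The gain from a deviation does not depend on the other buyers, so the equilibrium
  condition decouples into one maximization per buyer.\<close>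

lemma pure_nash_iff:
  "S \<in> pure_nash D (transaction_cost D \<alpha>) \<longleftrightarrow> S \<in> profiles D \<and>
    (\<forall>i\<in>buyers D. \<forall>\<gamma>\<in>orders D. effective_utility D \<alpha> i \<gamma> \<le> effective_utility D \<alpha> i (S i))"
proof -
  have "utility D (transaction_cost D \<alpha>) i (S(i := \<gamma>)) \<le> utility D (transaction_cost D \<alpha>) i S \<longleftrightarrow>
      effective_utility D \<alpha> i \<gamma> \<le> effective_utility D \<alpha> i (S i)"
    if "S \<in> profiles D" "i \<in> buyers D" "\<gamma> \<in> orders D" for i \<gamma>
    using utility_deviation[OF that, of \<alpha>] by linarith
  then show ?thesis
    unfolding pure_nash_def by auto
qed

text \<open>There are finitely many orders, so every buyer has a maximizer, and these together form
  an equilibrium. Hence the \<open>Max\<close> over equilibria in \<open>WRaE\<close> is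
  meaningful.\<close>

lemma pure_nash_nonempty: "pure_nash D (transaction_cost D \<alpha>) \<noteq> {}"
proof -
  have "\<exists>\<gamma>\<in>orders D. \<forall>\<gamma>'\<in>orders D. effective_utility D \<alpha> i \<gamma>' \<le> effective_utility D \<alpha> i \<gamma>" for i
  proof -
    have "Max (effective_utility D \<alpha> i ` orders D) \<in> effective_utility D \<alpha> i ` orders D"
      by (intro Max_in) auto
    then obtain \<gamma> where "\<gamma> \<in> orders D"
      "effective_utility D \<alpha> i \<gamma> = Max (effective_utility D \<alpha> i ` orders D)"
      by (metis imageE)
    then show ?thesis
      by (intro bexI[of _ \<gamma>]) auto
  qed
  then obtain m where m: "\<And>i. m i \<in> orders D"
    "\<And>i \<gamma>. \<gamma> \<in> orders D \<Longrightarrow> effective_utility D \<alpha> i \<gamma> \<le> effective_utility D \<alpha> i (m i)"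
    by metis
  \<comment> \<open>Profiles are extensional, so the choice is restricted to the set of
    buyers.\<close>
  then have "restrict m (buyers D) \<in> pure_nash D (transaction_cost D \<alpha>)"
    by (simp add: pure_nash_iff profiles_def)
  then show ?thesis
    by auto
qed

section \<open>Social welfare and the upper bound on the regret\<close>

text \<open>After an exchange of indices the two predicted sums agree, so the transfers cancel. The
  same exchange charges each true externality to the buyer who causes it.\<close>

lemma social_welfare_eq:
  assumes "S \<in> profiles D"
  shows "social_welfare D (transaction_cost D \<alpha>) S =
    (\<Sum>i\<in>buyers D. welfare_contribution D i (S i))"
proof -
  have "social_welfare D (transaction_cost D \<alpha>) S =
    (\<Sum>i\<in>buyers D. mean_gain D i (S i))
      - \<alpha> * (\<Sum>i\<in>buyers D. \<Sum>j\<in>buyers D - {i}. mean_pred_extern D j i (S i))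
      - (\<Sum>i\<in>buyers D. \<Sum>j\<in>buyers D - {i}. mean_extern D i j (S j))
      + \<alpha> * (\<Sum>i\<in>buyers D. \<Sum>j\<in>buyers D - {i}. mean_pred_extern D i j (S j))"
    unfolding social_welfare_def
    using assms
    by (simp add: utility_eq effective_utility_def sum.distrib sum_subtractf sum_distrib_left)
  then show ?thesis
    unfolding welfare_contribution_def
    by (simp add: sum_off_diagonal_swap[of _ "\<lambda>i j. mean_pred_extern D i j (S j)"]
        sum_off_diagonal_swap[of _ "\<lambda>i j. mean_extern D i j (S j)"] sum_subtractf)
qed

text \<open>The true mean externality is the prediction plus the bias, and the fraction \<alpha> of
  the prediction is already part of the effective utility.\<close>

lemma welfare_contribution_eq:
  "welfare_contribution D i \<gamma> = effective_utility D \<alpha> i \<gamma>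
    - (1 - \<alpha>) * (\<Sum>j\<in>buyers D - {i}. mean_pred_extern D j i \<gamma>)
    - (\<Sum>j\<in>buyers D - {i}. bias D j i \<gamma>)"
  unfolding welfare_contribution_def effective_utility_def bias_def
  by (simp add: sum_subtractf algebra_simps)

lemma bias_difference_le_Max:
  assumes "\<gamma> \<in> orders D" "\<gamma>' \<in> orders D"
  shows "bias D i j \<gamma> - bias D i j \<gamma>' \<le>
    Max ((\<lambda>(\<gamma>1, \<gamma>2). \<bar>bias D i j \<gamma>1 - bias D i j \<gamma>2\<bar>) ` (orders D \<times> orders D))"
proof -
  have "\<bar>bias D i j \<gamma> - bias D i j \<gamma>'\<bar> \<le>
    Max ((\<lambda>(\<gamma>1, \<gamma>2). \<bar>bias D i j \<gamma>1 - bias D i j \<gamma>2\<bar>) ` (orders D \<times> orders D))"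
    using assms by (intro Max_ge) auto
  then show ?thesis
    by linarith
qed

text \<open>The best equilibrium is at least as good as any fixed one, so it suffices to compare an
  arbitrary profile \<open>R\<close> with one equilibrium \<open>S\<close>. Buyer by buyer, the
  three terms of \<open>welfare_contribution_eq\<close> are bounded separately.\<close>

lemma WRaE_upper_bound:
  assumes "\<alpha> \<le> 1"
  shows "WRaE D (transaction_cost D \<alpha>) \<le> real (num_buyers D) * (1 - \<alpha>) + max_bias_variation D"
proof -
  let ?W = "social_welfare D (transaction_cost D \<alpha>)"
  let ?M = "\<lambda>i j. Max ((\<lambda>(\<gamma>1, \<gamma>2). \<bar>bias D i j \<gamma>1 - bias D i j \<gamma>2\<bar>) ` (orders D \<times> orders D))"
  obtain S where S: "S \<in> pure_nash D (transaction_cost D \<alpha>)"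
    using pure_nash_nonempty by auto
  then have SP: "S \<in> profiles D"
    by (simp add: pure_nash_def)
  have "?W R \<le> real (num_buyers D) * (1 - \<alpha>) + max_bias_variation D + ?W S"
    if R: "R \<in> profiles D" for R
  proof -
    have "welfare_contribution D i (R i) - welfare_contribution D i (S i) \<le>
        (1 - \<alpha>) + (\<Sum>j\<in>buyers D - {i}. ?M j i)" if i: "i \<in> buyers D" for i
    proof -
      let ?p = "\<lambda>\<gamma>. \<Sum>j\<in>buyers D - {i}. mean_pred_extern D j i \<gamma>"
      note ord = profiles_apply[OF SP i] profiles_apply[OF R i]
      have "effective_utility D \<alpha> i (R i) \<le> effective_utility D \<alpha> i (S i)"
        using S i ord by (simp add: pure_nash_iff)
      \<comment> \<open>Both totals lie between 0 and 1, so they differ by at most 1, and the factor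
        1 - \<alpha> is nonnegative.\<close>
      moreover have "(1 - \<alpha>) * (?p (S i) - ?p (R i)) \<le> (1 - \<alpha>) * 1"
        using sum_mean_pred_extern_range[OF i ord(1)] sum_mean_pred_extern_range[OF i ord(2)] assms
        by (intro mult_left_mono) auto
      moreover have "(\<Sum>j\<in>buyers D - {i}. bias D j i (S i) - bias D j i (R i)) \<le>
          (\<Sum>j\<in>buyers D - {i}. ?M j i)"
        using ord by (intro sum_mono bias_difference_le_Max)
      ultimately show ?thesis
        unfolding welfare_contribution_eq[of _ _ \<alpha>] by (simp add: sum_subtractf algebra_simps)
    qed
    then have "(\<Sum>i\<in>buyers D. welfare_contribution D i (R i) - welfare_contribution D i (S i)) \<le>
        (\<Sum>i\<in>buyers D. (1 - \<alpha>) + (\<Sum>j\<in>buyers D - {i}. ?M j i))"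
      by (rule sum_mono)
    \<comment> \<open>In \<open>max_bias_variation\<close> the outer sum runs over the buyer who
      suffers, in the bound above over the buyer who causes; hence the exchange.\<close>
    also have "\<dots> = real (num_buyers D) * (1 - \<alpha>) + max_bias_variation D"
      unfolding max_bias_variation_def sum_off_diagonal_swap[OF finite_buyers, of ?M D]
      by (simp add: sum.distrib buyers_def)
    finally show ?thesis
      by (simp add: social_welfare_eq R SP sum_subtractf)
  qed
  then have "Max (?W ` profiles D) \<le>
      real (num_buyers D) * (1 - \<alpha>) + max_bias_variation D + ?W S"
    using SP by (subst Max_le_iff) auto
  moreover have "?W S \<le> Max (?W ` pure_nash D (transaction_cost D \<alpha>))"
    using S by (intro Max_ge) auto
  ultimately show ?thesis
    unfolding WRaE_def by linarith
qed

text \<open>The \<open>Max\<close> over a finite nonempty set of equilibria is attained, so a gap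
  that holds for every equilibrium holds for the best one.\<close>

lemma WRaE_lower_bound:
  assumes "R \<in> profiles D"
    and "\<And>S. S \<in> pure_nash D T \<Longrightarrow> social_welfare D T S + c \<le> social_welfare D T R"
    and "pure_nash D T \<noteq> {}"
  shows "c \<le> WRaE D T"
proof -
  have "Max (social_welfare D T ` pure_nash D T) \<in> social_welfare D T ` pure_nash D T"
    using assms(3) by (intro Max_in) auto
  moreover have "social_welfare D T R \<le> Max (social_welfare D T ` profiles D)"
    using assms(1) by (intro Max_ge) auto
  ultimately show ?thesis
    unfolding WRaE_def using assms(2) by force
qed

text \<open>Every equilibrium is a profile. This settles the case \<alpha> = 1 of the worst-case
  bound.\<close>

lemma WRaE_nonneg: "0 \<le> WRaE D (transaction_cost D \<alpha>)"
  unfolding WRaE_def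
  using pure_nash_nonempty by (auto intro!: Max_mono simp: pure_nash_def)

end

section \<open>The worst-case instance\<close>

text \<open>Everything is deterministic: the outcome measure is a point mass at
  \<open>undefined\<close>, which is available for every type of outcomes. The share 1 / (n - 1)
  makes a nonempty order impose total externality 1 on the n - 1 other buyers. Predictions are
  exact, so all biases vanish.\<close>

definition congested_market :: "nat \<Rightarrow> real \<Rightarrow> 'w market" where
  "congested_market n x =
    \<lparr>num_buyers = n, num_sellers = 1, outcomes = return (count_space UNIV) undefined,
     perf = (\<lambda>i \<gamma> \<omega>. if \<gamma> = {} then 0 else x), cost = (\<lambda>\<gamma>. 0),
     extern = (\<lambda>i j \<gamma> \<omega>. if \<gamma> = {} then 0 else 1 / real (n - 1)),
     pred_extern = (\<lambda>i j \<gamma> \<omega>. if \<gamma> = {} then 0 else 1 / real (n - 1))\<rparr>"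

lemma congested_market_simps [simp]:
  "num_buyers (congested_market n x) = n"
  "buyers (congested_market n x) = {..<n}"
  "orders (congested_market n x) = {{}, {0}}"
  by (auto simp: congested_market_def buyers_def orders_def lessThan_Suc)

lemma prob_space_congested_market: "prob_space (outcomes (congested_market n x))"
  by (auto simp: congested_market_def intro: prob_space_return)

lemma data_market_congested:
  assumes "n \<ge> 2" "0 \<le> x" "x \<le> 1"
  shows "data_market (congested_market n x)"
proof -
  have "(\<Sum>j\<in>{..<n} - {i}. if \<gamma> = {} then 0 else 1 / real (n - 1)) \<in> {0..1}"
    if "i < n" for i and \<gamma> :: "nat set"
    using that assms(1) by simp
  then show ?thesis
    using assms(2,3)
    by (intro data_market.intro prob_space_congested_market)
      (simp_all only: congested_market_simps, simp_all add: congested_market_def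
        finite_measure.integrable_const[OF prob_space.finite_measure[OF prob_space_return]])
qed

lemma congested_market_means:
  fixes n :: nat and x :: real and D :: "'w market"
  defines "D \<equiv> congested_market n x"
  shows "mean_gain D i \<gamma> = (if \<gamma> = {} then 0 else x)"
    and "mean_extern D i j \<gamma> = (if \<gamma> = {} then 0 else 1 / real (n - 1))"
    and "mean_pred_extern D i j \<gamma> = (if \<gamma> = {} then 0 else 1 / real (n - 1))"
proof -
  interpret prob_space "outcomes D"
    unfolding D_def by (rule prob_space_congested_market)
  have "gain D i \<gamma> = (\<lambda>\<omega>. if \<gamma> = {} then 0 else x)"
    "extern D i j \<gamma> = (\<lambda>\<omega>. if \<gamma> = {} then 0 else 1 / real (n - 1))"
    "pred_extern D i j \<gamma> = (\<lambda>\<omega>. if \<gamma> = {} then 0 else 1 / real (n - 1))"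
    by (auto simp: D_def congested_market_def gain_def)
  then show "mean_gain D i \<gamma> = (if \<gamma> = {} then 0 else x)"
    "mean_extern D i j \<gamma> = (if \<gamma> = {} then 0 else 1 / real (n - 1))"
    "mean_pred_extern D i j \<gamma> = (if \<gamma> = {} then 0 else 1 / real (n - 1))"
    unfolding mean_gain_def mean_extern_def mean_pred_extern_def
    by (simp_all only: lebesgue_integral_const prob_space scaleR_one)
qed

text \<open>The buyer is charged only the fraction \<alpha> of the total externality 1 that a
  nonempty order causes, while the welfare bears all of it. The regret comes from this
  difference.\<close>

lemma congested_market_effective_utility:
  assumes "n \<ge> 2" "i < n"
  shows "effective_utility (congested_market n x) \<alpha> i \<gamma> = (if \<gamma> = {} then 0 else x - \<alpha>)"
  using assms by (simp add: effective_utility_def congested_market_means)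

lemma congested_market_welfare_contribution:
  assumes "n \<ge> 2" "i < n"
  shows "welfare_contribution (congested_market n x) i \<gamma> = (if \<gamma> = {} then 0 else x - 1)"
  using assms by (simp add: welfare_contribution_def congested_market_means)

text \<open>In every equilibrium all buyers order, with welfare n (x - 1), whereas the empty profile
  has welfare 0. The inequality \<alpha> < x must be strict: at x = \<alpha> the empty profile would
  itself be an equilibrium and the regret would vanish.\<close>

lemma WRaE_congested_market:
  fixes n :: nat and x :: real and D :: "'w market"
  defines "D \<equiv> congested_market n x"
  assumes n: "n \<ge> 2" and x: "\<alpha> < x" "0 \<le> x" "x \<le> 1"
  shows "real n * (1 - x) \<le> WRaE D (transaction_cost D \<alpha>)"
proof -
  interpret data_market D
    unfolding D_def by (rule data_market_congested[OF n x(2,3)])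
  define R where "R = restrict (\<lambda>i. {} :: nat set) {..<n}"
  have R: "R \<in> profiles D"
    by (auto simp: R_def D_def profiles_def)
  have WR: "social_welfare D (transaction_cost D \<alpha>) R = 0"
    unfolding social_welfare_eq[OF R]
    using n by (simp add: D_def R_def congested_market_welfare_contribution)
  have WS: "social_welfare D (transaction_cost D \<alpha>) S = real n * (x - 1)"
    if S: "S \<in> pure_nash D (transaction_cost D \<alpha>)" for S
  proof -
    have SP: "S \<in> profiles D"
      using S by (simp add: pure_nash_iff)
    have "S i \<noteq> {}" if "i < n" for i
    proof -
      \<comment> \<open>Ordering \<open>{0}\<close> has effective utility x - \<alpha> > 0, while
        \<open>{}\<close> has 0.\<close>
      have "effective_utility D \<alpha> i {0} \<le> effective_utility D \<alpha> i (S i)"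
        using S[unfolded pure_nash_iff] that by (auto simp: D_def)
      then show ?thesis
        using x n that by (auto simp: D_def congested_market_effective_utility split: if_splits)
    qed
    then show ?thesis
      unfolding social_welfare_eq[OF SP]
      using n by (simp add: D_def congested_market_welfare_contribution)
  qed
  show ?thesis
    using R by (rule WRaE_lower_bound[OF _ _ pure_nash_nonempty]) (simp add: WS WR algebra_simps)
qed

lemma WRaE_worst_case:
  assumes \<alpha>: "0 \<le> \<alpha>" "\<alpha> \<le> 1" and n: "n \<ge> 2" and \<eta>: "\<eta> > 0"
  shows "\<exists>D :: 'w market. data_market D \<and> num_buyers D = n \<and>
    WRaE D (transaction_cost D \<alpha>) \<ge> real n * (1 - \<alpha>) - \<eta>"
proof -
  \<comment> \<open>The excess \<eta> / n over \<alpha> lowers the regret by at most \<eta> over all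
    n buyers; the cap at 1 keeps the performance in the unit interval.\<close>
  define x where "x = min 1 (\<alpha> + \<eta> / real n)"
  have x: "0 \<le> x" "x \<le> 1"
    using \<alpha> \<eta> by (auto simp: x_def)
  define D :: "'w market" where "D = congested_market n x"
  have D: "data_market D"
    unfolding D_def by (rule data_market_congested[OF n x])
  have "real n * (1 - \<alpha>) - \<eta> \<le> WRaE D (transaction_cost D \<alpha>)"
  proof (cases "\<alpha> = 1")
    \<comment> \<open>No x satisfies \<alpha> < x \<le> 1 here, but the claimed bound is just
      -\<eta>.\<close>
    case True
    then show ?thesis
      using data_market.WRaE_nonneg[OF D, of \<alpha>] \<eta> by simp
  next
    case False
    then have "\<alpha> < x"
      using \<alpha> \<eta> n by (simp add: x_def)
    then have "real n * (1 - x) \<le> WRaE D (transaction_cost D \<alpha>)"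
      unfolding D_def by (rule WRaE_congested_market[OF n _ x])
    moreover have "real n * x \<le> real n * (\<alpha> + \<eta> / real n)"
      by (intro mult_left_mono) (auto simp: x_def)
    ultimately show ?thesis
      using n by (simp add: algebra_simps)
  qed
  then show ?thesis
    using D by (auto simp: D_def)
qed

theorem theorem1:
  fixes \<alpha> :: real
  assumes "0 \<le> \<alpha>" and "\<alpha> \<le> 1"
  shows "(\<forall>D :: 'w market. data_market D \<longrightarrow>
            (\<forall>i\<in>buyers D. \<forall>\<gamma>d.
               is_arg_max (effective_utility D \<alpha> i) (\<lambda>\<gamma>. \<gamma> \<in> orders D) \<gamma>d \<longrightarrow>
               dominant_strategy D (transaction_cost D \<alpha>) i \<gamma>d) \<and>
            pure_nash D (transaction_cost D \<alpha>) \<noteq> {} \<and>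
            WRaE D (transaction_cost D \<alpha>)
              \<le> real (num_buyers D) * (1 - \<alpha>) + max_bias_variation D) \<and>
         (\<forall>n::nat. \<forall>\<eta>::real. n \<ge> 2 \<and> \<eta> > 0 \<longrightarrow>
            (\<exists>D :: 'w market. data_market D \<and> num_buyers D = n \<and>
               WRaE D (transaction_cost D \<alpha>) \<ge> real n * (1 - \<alpha>) - \<eta>))"
proof (intro conjI allI impI ballI)
  fix D :: "'w market" and i \<gamma>d
  assume "data_market D" "i \<in> buyers D"
    "is_arg_max (effective_utility D \<alpha> i) (\<lambda>\<gamma>. \<gamma> \<in> orders D) \<gamma>d"
  then show "dominant_strategy D (transaction_cost D \<alpha>) i \<gamma>d"
    by (rule data_market.dominant_strategy_if_arg_max)
next
  fix D :: "'w market"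
  assume D: "data_market D"
  show "pure_nash D (transaction_cost D \<alpha>) \<noteq> {}"
    by (rule data_market.pure_nash_nonempty[OF D])
  show "WRaE D (transaction_cost D \<alpha>) \<le> real (num_buyers D) * (1 - \<alpha>) + max_bias_variation D"
    using D assms(2) by (rule data_market.WRaE_upper_bound)
next
  fix n :: nat and \<eta> :: real
  assume "n \<ge> 2 \<and> \<eta> > 0"
  then show "\<exists>D :: 'w market. data_market D \<and> num_buyers D = n \<and>
      WRaE D (transaction_cost D \<alpha>) \<ge> real n * (1 - \<alpha>) - \<eta>"
    using WRaE_worst_case assms by blast
qed

end
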